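(* Let $1\leq k\leq n$ and let $\Lambda_1,\dots,\Lambda_d\subset\mathbb{P}^n$ be an indecomposable sequence of $(k-1)$-dimensional linear subspaces in special position with respect to $(n-k)$-planes. Then $$\dim\mathrm{Span}(\Lambda_1,\dots,\Lambda_d)\leq d+k-3.$$
   Context: Let $\Lambda_1,\dots,\Lambda_d\subset\mathbb{P}^N$ be $(k-1)$-dimensional linear subspaces (not necessarily distinct). They are said to be in special position with respect to $(N-k)$-planes, written $\mathrm{SP}(N-k)$, if for every $j\in\{1,\dots,d\}$ and every $(N-k)$-dimensional linear subspace $L\subset\mathbb{P}^N$ meeting each of $\Lambda_1,\dots,\Lambda_{j-1},\Lambda_{j+1},\dots,\Lambda_d$, the subspace $L$ also meets $\Lambda_j$. A sequence $\Lambda_1,\dots,\Lambda_d$ satisfying $\mathrm{SP}(N-k)$ is decomposable if there is a partition of the index set $\{1,\dots,d\}$ into at least two nonempty parts such that, for each part $\{i_1,\dots,i_t\}$, the subspaces $\Lambda_{i_1},\dots,\Lambda_{i_t}$ satisfy $\mathrm{SP}(N-k)$; otherwise it is indecomposable. $\mathrm{Span}$ denotes linear span in $\mathbb{P}^N$. *)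

theory Defs
  imports "HOL-Analysis.Analysis" "HOL-Library.Disjoint_Sets"
begin

text \<open>Projective space P^n over the complex numbers is modelled as the set of lines of
  the complex vector space complex^'m with CARD('m) = n+1.  A projective linear subspace
  of dimension r corresponds to a complex-linear subspace of dimension r+1.\<close>

type_synonym 'm cvec = "complex ^ ('m::finite)"

definition proj_subspace_of_dim :: "('m::finite) cvec set \<Rightarrow> nat \<Rightarrow> bool" where
  "proj_subspace_of_dim L r \<longleftrightarrow> vec.subspace L \<and> vec.dim L = r + 1"

definition meets :: "('m::finite) cvec set \<Rightarrow> ('m::finite) cvec set \<Rightarrow> bool" where
  "meets L M \<longleftrightarrow> (\<exists>v. v \<noteq> 0 \<and> v \<in> L \<and> v \<in> M)"

definition special_position :: "nat \<Rightarrow> nat set \<Rightarrow> (nat \<Rightarrow> ('m::finite) cvec set) \<Rightarrow> bool" where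
  "special_position r I Lam \<longleftrightarrow>
     (\<forall>j\<in>I. \<forall>L. proj_subspace_of_dim L r \<and> (\<forall>i\<in>I - {j}. meets L (Lam i))
        \<longrightarrow> meets L (Lam j))"

definition decomposable :: "nat \<Rightarrow> nat set \<Rightarrow> (nat \<Rightarrow> ('m::finite) cvec set) \<Rightarrow> bool" where
  "decomposable r I Lam \<longleftrightarrow> special_position r I Lam \<and>
     (\<exists>P. partition_on I P \<and> card P \<ge> 2 \<and> (\<forall>p\<in>P. special_position r p Lam))"

definition indecomposable :: "nat \<Rightarrow> nat set \<Rightarrow> (nat \<Rightarrow> ('m::finite) cvec set) \<Rightarrow> bool" where
  "indecomposable r I Lam \<longleftrightarrow> special_position r I Lam \<and> \<not> decomposable r I Lam"

definition proj_span_dim :: "('m::finite) cvec set \<Rightarrow> int" where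
  "proj_span_dim S = int (vec.dim (vec.span S)) - 1"

end

theory Submission
  imports Defs
begin

text \<open>
  \<^bold>\<open>Idea.\<close> Write \<open>W\<^sub>i\<close> for the \<open>k\<close>-dimensional vector subspace behind \<open>\<Lambda>\<^sub>i\<close>, and \<open>W\<^sub>A\<close> for the
  span of the \<open>W\<^sub>i\<close> with \<open>i \<in> A\<close>. Since a subspace that misses \<open>W\<^sub>j\<close> extends to a complement of
  \<open>W\<^sub>j\<close>, special position says that for every \<open>j\<close> the span of any nonzero vectors \<open>u\<^sub>i \<in> W\<^sub>i\<close>,
  \<open>i \<noteq> j\<close>, meets \<open>W\<^sub>j\<close>. Fix an index \<open>o\<close> and let \<open>S\<close> minimise \<open>dim W\<^sub>S - |S|\<close> among the index sets
  containing \<open>o\<close>. By Rado's theorem there are \<open>t\<^sub>i \<in> W\<^sub>i\<close>, \<open>i \<notin> S\<close>, independent modulo \<open>W\<^sub>S\<close>. Special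
  position at \<open>o\<close> therefore excludes \<open>S = {o}\<close> as a minimiser, so \<open>dim W\<^sub>S \<le> |S| + k - 2\<close>; this is
  the bound if \<open>S\<close> contains all indices. Otherwise both \<open>S\<close> and its complement are in special
  position, so the sequence is decomposable.
\<close>

lemma Int_not_singleton_mono: "A \<inter> C \<noteq> {z} \<Longrightarrow> z \<in> A \<inter> C \<Longrightarrow> A \<inter> C \<subseteq> B \<Longrightarrow> B \<inter> C \<noteq> {z}"
  by blast

section \<open>Dimension counts and complements\<close>

context finite_dimensional_vector_space
begin

lemma span_of_subspace: "subspace S \<Longrightarrow> span S = S"
  by simp

lemma dim_Un_plus_dim_Int:
  "dim (X \<union> Y) + dim (span X \<inter> span Y) = dim X + dim Y"
proof -
  have "dim (X \<union> Y) = dim {x + y |x y. x \<in> span X \<and> y \<in> span Y}"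
    by (metis dim_span span_Un)
  then show ?thesis
    using dim_sums_Int[of "span X" "span Y"] by simp
qed

lemma dim_Un_le: "dim (X \<union> Y) \<le> dim X + dim Y"
  using dim_Un_plus_dim_Int[of X Y] by linarith

lemma dim_image_le_card: "finite D \<Longrightarrow> dim (t ` D) \<le> card D"
  by (meson card_image_le dim_le_card' finite_imageI le_trans)

lemma span_Int_span_image_eq_0:
  assumes "finite D" and "dim X + card D \<le> dim (X \<union> t ` D)"
  shows "span X \<inter> span (t ` D) = {0}"
proof -
  have "dim (span X \<inter> span (t ` D)) = 0"
    using dim_Un_plus_dim_Int[of X "t ` D"] dim_image_le_card[OF assms(1), of t] assms(2)
    by linarith
  then have "span X \<inter> span (t ` D) \<subseteq> {0}"
    by simp
  then show ?thesis
    using span_zero[of X] span_zero[of "t ` D"] by auto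
qed

lemma nonzero_if_dim_Un_image:
  assumes "finite D" and "dim X + card D \<le> dim (X \<union> t ` D)" and "i \<in> D"
  shows "t i \<noteq> 0"
proof
  assume "t i = 0"
  then have "X \<union> t ` D \<subseteq> span (X \<union> t ` (D - {i}))"
    by (auto intro: span_base) (metis DiffI UnCI image_eqI singletonD span_base span_zero)
  then have "dim (X \<union> t ` D) \<le> dim (X \<union> t ` (D - {i}))"
    by (rule dim_mono)
  also have "\<dots> \<le> dim X + card (D - {i})"
    using dim_Un_le[of X "t ` (D - {i})"] dim_image_le_card[of "D - {i}" t] assms(1) by simp
  also have "\<dots> < dim X + card D"
    using card_Diff1_less[OF assms(1,3)] by simp
  finally show False
    using assms(2) by simp
qed

text \<open>Take \<open>L\<close> of maximal dimension among the subspaces between \<open>U\<close>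
  and \<open>F\<close> that miss \<open>Y\<close>. A vector of \<open>F\<close> outside
  \<open>L + Y\<close> could be adjoined to \<open>L\<close> without creating an intersection with
  \<open>Y\<close>, so maximality forces \<open>L + Y = F\<close>.\<close>

lemma subspace_complement_containing:
  assumes F: "subspace F" and Y: "subspace Y" and U: "subspace U"
    and "Y \<subseteq> F" "U \<subseteq> F" "U \<inter> Y = {0}"
  obtains L where "subspace L" "U \<subseteq> L" "L \<subseteq> F" "L \<inter> Y = {0}" "dim L + dim Y = dim F"
proof -
  define P where "P L \<longleftrightarrow> subspace L \<and> U \<subseteq> L \<and> L \<subseteq> F \<and> L \<inter> Y = {0}" for L
  have "P U"
    using assms by (simp add: P_def)
  moreover have "\<forall>L. P L \<longrightarrow> dim L < Suc dimension"
    using dim_subset_UNIV by (simp add: less_Suc_eq_le)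
  ultimately obtain L where L: "P L" and max: "\<And>L'. P L' \<Longrightarrow> dim L' \<le> dim L"
    using ex_has_greatest_nat[of P U dim "Suc dimension"] by blast
  have sub: "subspace L" "L \<inter> Y = {0}" "L \<subseteq> F" "U \<subseteq> L"
    using L by (auto simp: P_def)
  have "F \<subseteq> span (L \<union> Y)"
  proof
    fix x assume "x \<in> F"
    show "x \<in> span (L \<union> Y)"
    proof (rule ccontr)
      assume x: "x \<notin> span (L \<union> Y)"
      have "span (insert x L) \<inter> Y \<subseteq> {0}"
      proof
        fix y assume "y \<in> span (insert x L) \<inter> Y"
        then obtain c where c: "y - scale c x \<in> span L" and "y \<in> Y"
          by (auto simp: span_breakdown_eq)
        then have "y \<in> span (L \<union> Y)" "y - scale c x \<in> span (L \<union> Y)"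
          using span_mono[of L "L \<union> Y"] span_superset[of "L \<union> Y"] by auto
        then have "scale c x \<in> span (L \<union> Y)"
          using span_diff[of y "L \<union> Y" "y - scale c x"] by simp
        then have "c = 0"
          using x span_scale[of "scale c x" "L \<union> Y" "inverse c"] by (cases "c = 0") auto
        then have "y \<in> L"
          using c sub(1) by (metis scale_zero_left diff_zero span_eq_iff)
        then show "y \<in> {0}"
          using sub(2) \<open>y \<in> Y\<close> by blast
      qed
      then have "P (span (insert x L))"
        using sub \<open>x \<in> F\<close> F Y span_superset[of "insert x L"] span_minimal[of "insert x L" F]
        by (auto simp: P_def intro: span_zero subspace_0)
      then have "dim (insert x L) \<le> dim L"
        using max by fastforce
      moreover have "x \<notin> span L"
        using x span_mono[of L "L \<union> Y"] by auto
      ultimately show False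
        by (simp add: dim_insert)
    qed
  qed
  then have "dim F = dim (L \<union> Y)"
    by (metis \<open>Y \<subseteq> F\<close> sub(3) Un_least dim_mono dim_subset le_antisym)
  moreover have "dim (span L \<inter> span Y) = 0"
    unfolding span_of_subspace[OF sub(1)] span_of_subspace[OF Y] sub(2) by simp
  ultimately have "dim L + dim Y = dim F"
    using dim_Un_plus_dim_Int[of L Y] by linarith
  then show ?thesis
    using that sub by blast
qed

section \<open>Generic vectors and independent representatives\<close>

lemma subspace_not_subset_Union:
  assumes inf: "infinite (UNIV :: 'a set)"
    and "finite \<F>" "subspace W" "\<And>S. S \<in> \<F> \<Longrightarrow> subspace S" "\<And>S. S \<in> \<F> \<Longrightarrow> \<not> W \<subseteq> S"
  shows "\<exists>w\<in>W. \<forall>S\<in>\<F>. w \<notin> S"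
  using assms(2-)
proof (induction \<F>)
  case empty
  then show ?case
    using subspace_0 by blast
next
  case (insert S \<F>)
  then obtain w where w: "w \<in> W" "\<forall>S\<in>\<F>. w \<notin> S"
    by auto
  obtain v where v: "v \<in> W" "v \<notin> S"
    using insert.prems by blast
  show ?case
  proof (cases "w \<in> S")
    case False
    then show ?thesis
      using w by blast
  next
    case True
    \<comment> \<open>The affine line through \<open>w\<close> in direction \<open>v\<close> hits
      \<open>S'\<close> at most once: two hits would put \<open>v\<close>, and then
      \<open>w\<close>, into \<open>S'\<close>.\<close>
    have "finite {c. w + scale c v \<in> S'}" if "S' \<in> \<F>" for S'
    proof -
      have S': "subspace S'"
        using that insert.prems by blast
      have "c = c'" if "w + scale c v \<in> S'" "w + scale c' v \<in> S'" for c c'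
      proof (rule ccontr)
        assume "c \<noteq> c'"
        have "scale (c - c') v \<in> S'"
          using subspace_diff[OF S' that] by (simp add: scale_left_diff_distrib)
        then have "scale (inverse (c - c')) (scale (c - c') v) \<in> S'"
          by (rule subspace_scale[OF S'])
        then have "v \<in> S'"
          using \<open>c \<noteq> c'\<close> by simp
        then have "w \<in> S'"
          using subspace_diff[OF S' that(1) subspace_scale[OF S', of v c]] by simp
        then show False
          using w \<open>S' \<in> \<F>\<close> by blast
      qed
      then have "{c. w + scale c v \<in> S'} = {} \<or> (\<exists>c. {c. w + scale c v \<in> S'} = {c})"
        by blast
      then show ?thesis
        by auto
    qed
    \<comment> \<open>The value 0 is excluded because \<open>w\<close> itself lies in
      \<open>S\<close>; any other multiple of \<open>v\<close> moves it out of
      \<open>S\<close>.\<close>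
    then have "finite (insert 0 (\<Union>S'\<in>\<F>. {c. w + scale c v \<in> S'}))"
      using insert.hyps by auto
    then obtain c where c: "c \<noteq> 0" "\<forall>S'\<in>\<F>. w + scale c v \<notin> S'"
      using ex_new_if_finite[OF inf] by force
    have S: "subspace S"
      using insert.prems by blast
    have "w + scale c v \<notin> S"
    proof
      assume "w + scale c v \<in> S"
      then have "scale c v \<in> S"
        using subspace_diff[OF S _ True] by fastforce
      then have "scale (inverse c) (scale c v) \<in> S"
        by (rule subspace_scale[OF S])
      then show False
        using c v by simp
    qed
    moreover have "w + scale c v \<in> W"
      using insert.prems(1) w v by (simp add: subspace_add subspace_scale)
    ultimately show ?thesis
      using c by blast
  qed
qed

text \<open>
  Rado's theorem on independent representatives, in a defect form and for two subspaces at once;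
  representatives serving both exist because a generic choice works over an infinite field.
\<close>

lemma rado_representatives:
  assumes inf: "infinite (UNIV :: 'a set)"
    and "finite D" "\<And>i. i \<in> D \<Longrightarrow> subspace (W i)"
    and "\<And>A. A \<subseteq> D \<Longrightarrow> n + card A \<le> dim (X \<union> \<Union>(W ` A))"
    and "\<And>A. A \<subseteq> D \<Longrightarrow> m + card A \<le> dim (Y \<union> \<Union>(W ` A))"
  shows "\<exists>t. (\<forall>i\<in>D. t i \<in> W i) \<and> n + card D \<le> dim (X \<union> t ` D) \<and> m + card D \<le> dim (Y \<union> t ` D)"
  using assms(2-)
proof (induction D arbitrary: X Y n m rule: finite_induct)
  case empty
  show ?case
    using empty.prems(2)[of "{}"] empty.prems(3)[of "{}"] by auto
next
  case (insert i D)
  \<comment> \<open>These finitely many spans, where the lower bound is attained, are what the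
    representative \<open>w\<close> of \<open>i\<close> has to avoid. None contains
    \<open>W i\<close>, since adding \<open>i\<close> to such an \<open>A\<close> would then violate
    the bound.\<close>
  define tight where
    "tight Z l = {span (Z \<union> \<Union>(W ` A)) |A. A \<subseteq> D \<and> dim (Z \<union> \<Union>(W ` A)) = l + card A}" for Z l
  have fin: "finite (tight Z l)" for Z l
    using finite_subset[of "tight Z l" "(\<lambda>A. span (Z \<union> \<Union>(W ` A))) ` Pow D"] insert.hyps(1)
    by (auto simp: tight_def)
  have proper: "\<not> W i \<subseteq> S"
    if dims: "\<And>A. A \<subseteq> insert i D \<Longrightarrow> l + card A \<le> dim (Z \<union> \<Union>(W ` A))" and "S \<in> tight Z l" for Z l S
  proof
    assume "W i \<subseteq> S"
    obtain A where A: "A \<subseteq> D" "dim (Z \<union> \<Union>(W ` A)) = l + card A" "S = span (Z \<union> \<Union>(W ` A))"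
      using \<open>S \<in> tight Z l\<close> by (auto simp: tight_def)
    have "dim (Z \<union> \<Union>(W ` insert i A)) \<le> dim (Z \<union> \<Union>(W ` A))"
      by (rule dim_mono) (use \<open>W i \<subseteq> S\<close> A(3) span_superset[of "Z \<union> \<Union>(W ` A)"] in auto)
    moreover have "card (insert i A) = Suc (card A)"
      using A(1) insert.hyps by (meson card_insert_disjoint finite_subset subset_iff)
    moreover have "insert i A \<subseteq> insert i D"
      using A(1) by blast
    ultimately show False
      using dims[of "insert i A"] A(2) by simp
  qed
  have "\<exists>w\<in>W i. \<forall>S\<in>tight X n \<union> tight Y m. w \<notin> S"
  proof (rule subspace_not_subset_Union[OF inf])
    show "\<not> W i \<subseteq> S" if "S \<in> tight X n \<union> tight Y m" for S
      using that proper[OF insert.prems(2)] proper[OF insert.prems(3)] by blast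
  qed (use fin insert.prems(1) in \<open>auto simp: tight_def\<close>)
  then obtain w where w: "w \<in> W i" "\<And>S. S \<in> tight X n \<Longrightarrow> w \<notin> S" "\<And>S. S \<in> tight Y m \<Longrightarrow> w \<notin> S"
    by blast
  \<comment> \<open>In the tight case \<open>w\<close> adds a dimension; otherwise the bound already
    had slack one. Thus the induction hypothesis applies with \<open>w\<close> adjoined to both base
    sets.\<close>
  have step: "Suc l + card A \<le> dim (insert w Z \<union> \<Union>(W ` A))"
    if dims: "\<And>A. A \<subseteq> insert i D \<Longrightarrow> l + card A \<le> dim (Z \<union> \<Union>(W ` A))"
      and "\<And>S. S \<in> tight Z l \<Longrightarrow> w \<notin> S" and "A \<subseteq> D" for Z l A
  proof (cases "dim (Z \<union> \<Union>(W ` A)) = l + card A")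
    case True
    then have "w \<notin> span (Z \<union> \<Union>(W ` A))"
      using that by (auto simp: tight_def)
    then show ?thesis
      using True by (simp add: dim_insert)
  next
    case False
    then have "l + card A < dim (Z \<union> \<Union>(W ` A))"
      using dims[of A] \<open>A \<subseteq> D\<close> by fastforce
    also have "\<dots> \<le> dim (insert w Z \<union> \<Union>(W ` A))"
      by (rule dim_subset) auto
    finally show ?thesis
      by simp
  qed
  obtain t where t: "\<forall>j\<in>D. t j \<in> W j"
    "Suc n + card D \<le> dim (insert w X \<union> t ` D)" "Suc m + card D \<le> dim (insert w Y \<union> t ` D)"
    using insert.IH[of "Suc n" "insert w X" "Suc m" "insert w Y"] insert.prems(1)
      step[OF insert.prems(2) w(2)] step[OF insert.prems(3) w(3)] by blast
  have "insert w Z \<union> t ` D = Z \<union> (t(i := w)) ` insert i D" for Z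
    using insert.hyps by auto
  then show ?case
    using t w(1) insert.hyps by (intro exI[of _ "t(i := w)"]) simp
qed

lemma ex_tight_subset:
  assumes "finite J"
  shows "\<exists>B. B \<subseteq> J \<and> (B = {} \<or> dim (X \<union> \<Union>(W ` B)) < dim X + card B) \<and>
    (\<forall>A. A \<subseteq> J - B \<longrightarrow>
      dim (X \<union> \<Union>(W ` B)) + card A \<le> dim (X \<union> \<Union>(W ` B) \<union> \<Union>(W ` A)))"
proof -
  define g where "g A = int (dim (X \<union> \<Union>(W ` A))) - int (card A)" for A
  have "finite (Pow J)" "Pow J \<noteq> {}"
    using assms by auto
  then obtain B0 where B0: "B0 \<subseteq> J" and "\<And>A. A \<subseteq> J \<Longrightarrow> \<not> g A < g B0"
    using ex_is_arg_min_if_finite[of "Pow J" g] by (auto simp: is_arg_min_def)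
  then have min: "g B0 \<le> g A" if "A \<subseteq> J" for A
    using that by (meson not_less)
  \<comment> \<open>Preferring the empty set in case of a tie makes the inequality for a nonempty
    \<open>B\<close> strict.\<close>
  define B where "B = (if g B0 < g {} then B0 else {})"
  have B: "B \<subseteq> J" "g B \<le> g B0" "B = {} \<or> g B < g {}"
    using B0 by (simp_all add: B_def)
  show ?thesis
  proof (intro exI[of _ B] conjI allI impI B(1))
    show "B = {} \<or> dim (X \<union> \<Union>(W ` B)) < dim X + card B"
      using B(3) by (auto simp: g_def)
    show "dim (X \<union> \<Union>(W ` B)) + card A \<le> dim (X \<union> \<Union>(W ` B) \<union> \<Union>(W ` A))"
      if "A \<subseteq> J - B" for A
    proof -
      have "g B \<le> g (B \<union> A)"
        using that B(1) by (intro order_trans[OF B(2) min]) blast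
      moreover have "card (B \<union> A) = card B + card A"
        using that B(1) assms by (intro card_Un_disjoint) (auto intro: finite_subset)
      moreover have "X \<union> \<Union>(W ` (B \<union> A)) = X \<union> \<Union>(W ` B) \<union> \<Union>(W ` A)"
        by auto
      ultimately show ?thesis
        by (simp add: g_def)
    qed
  qed
qed

section \<open>Special position of vector subspaces\<close>

lemma span_Un_Int_absorb:
  assumes "U \<subseteq> span G" "Y \<subseteq> span G" "span G \<inter> span T = {0}"
  shows "span (U \<union> T) \<inter> Y \<subseteq> span U"
proof
  fix w assume w: "w \<in> span (U \<union> T) \<inter> Y"
  then obtain a b where ab: "w = a + b" "a \<in> span U" "b \<in> span T"
    by (auto simp: span_Un)
  have "a \<in> span G"
    using ab(2) span_minimal[OF assms(1) subspace_span] by blast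
  then have "w - a \<in> span G"
    using w assms(2) by (blast intro: span_diff)
  then have "b \<in> span G \<inter> span T"
    using ab by simp
  then have "b = 0"
    using assms(3) by blast
  then show "w \<in> span U"
    using ab by simp
qed

text \<open>
  The name is qualified by \<open>local\<close> below because an unqualified use resolves to the instance of
  the definition for Euclidean spaces.
\<close>

definition special_at :: "'i set \<Rightarrow> ('i \<Rightarrow> 'b set) \<Rightarrow> 'i \<Rightarrow> bool" where
  "special_at I W j \<longleftrightarrow>
     (\<forall>u. (\<forall>i\<in>I - {j}. u i \<in> W i \<and> u i \<noteq> 0) \<longrightarrow> span (u ` (I - {j})) \<inter> W j \<noteq> {0})"

text \<open>Complete \<open>u\<close> by representatives outside \<open>S\<close> that are
  independent modulo the span of the \<open>W i\<close> with \<open>i \<in> S\<close>. Their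
  contribution to a vector of \<open>W j\<close> vanishes, so the intersection found in
  \<open>I\<close> already comes from \<open>u\<close>.\<close>

lemma special_at_independent_complement:
  assumes inf: "infinite (UNIV :: 'a set)" and "finite I" and W: "\<And>i. i \<in> I \<Longrightarrow> subspace (W i)"
    and "S \<subseteq> I" "j \<in> S" and special: "local.special_at I W j"
    and indep: "\<And>A. A \<subseteq> I - S \<Longrightarrow> dim (\<Union>(W ` S)) + card A \<le> dim (\<Union>(W ` S) \<union> \<Union>(W ` A))"
  shows "local.special_at S W j"
  unfolding local.special_at_def
proof (intro allI impI)
  fix u assume u: "\<forall>i\<in>S - {j}. u i \<in> W i \<and> u i \<noteq> 0"
  have fin: "finite (I - S)"
    using \<open>finite I\<close> by simp
  obtain t where t: "\<forall>i\<in>I - S. t i \<in> W i"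
    "dim (\<Union>(W ` S)) + card (I - S) \<le> dim (\<Union>(W ` S) \<union> t ` (I - S))"
    using rado_representatives[OF inf fin _ indep indep] W by blast
  define v where "v i = (if i \<in> S then u i else t i)" for i
  have "\<forall>i\<in>I - {j}. v i \<in> W i \<and> v i \<noteq> 0"
    using u t(1) nonzero_if_dim_Un_image[OF fin t(2)] by (auto simp: v_def)
  then have "span (v ` (I - {j})) \<inter> W j \<noteq> {0}"
    using special unfolding local.special_at_def by blast
  moreover have "v ` (I - {j}) = u ` (S - {j}) \<union> t ` (I - S)"
    using \<open>S \<subseteq> I\<close> \<open>j \<in> S\<close> by (auto simp: v_def image_iff)
  moreover have "u ` (S - {j}) \<subseteq> span (\<Union>(W ` S))" "W j \<subseteq> span (\<Union>(W ` S))"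
    using u \<open>j \<in> S\<close> span_superset[of "\<Union>(W ` S)"] by blast+
  then have "span (u ` (S - {j}) \<union> t ` (I - S)) \<inter> W j \<subseteq> span (u ` (S - {j}))"
    by (rule span_Un_Int_absorb[OF _ _ span_Int_span_image_eq_0[OF fin t(2)]])
  moreover have "0 \<in> span (u ` (S - {j}) \<union> t ` (I - S)) \<inter> W j"
    using W assms(4,5) by (simp add: span_zero subspace_0 subsetD)
  ultimately show "span (u ` (S - {j})) \<inter> W j \<noteq> {0}"
    by (metis Int_not_singleton_mono)
qed

text \<open>
  The subspace \<open>L\<close> in the proof has codimension less than \<open>dim (W j)\<close> in the span of the \<open>W i\<close>,
  \<open>i \<in> S\<close>, and the \<open>u i\<close>, so it meets every \<open>W i\<close> with \<open>i \<in> S\<close> for free, although it misses \<open>W j\<close>.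
\<close>

lemma special_at_meets_outside:
  assumes W: "\<And>i. i \<in> I \<Longrightarrow> subspace (W i)" and "S \<subseteq> I" "j \<in> I - S" and special: "local.special_at I W j"
    and dims: "\<And>i. i \<in> S \<Longrightarrow> dim (W j) \<le> dim (W i)"
    and u: "\<And>i. i \<in> I - S - {j} \<Longrightarrow> u i \<in> W i \<and> u i \<noteq> 0"
    and nsub: "\<not> W j \<subseteq> span (\<Union>(W ` S) \<union> u ` (I - S - {j}))"
  shows "span (u ` (I - S - {j})) \<inter> W j \<noteq> {0}"
proof
  let ?U = "span (u ` (I - S - {j}))"
  let ?F = "span (\<Union>(W ` S) \<union> u ` (I - S - {j}))"
  assume miss: "?U \<inter> W j = {0}"
  have Wj: "subspace (W j)"
    using W assms(3) by blast
  have "?U \<subseteq> ?F"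
    by (rule span_mono) auto
  moreover have "?U \<inter> (W j \<inter> ?F) = {0}"
    using miss span_zero by blast
  ultimately obtain L where L: "subspace L" "?U \<subseteq> L" "L \<subseteq> ?F" "L \<inter> (W j \<inter> ?F) = {0}"
    "dim L + dim (W j \<inter> ?F) = dim ?F"
    by (rule subspace_complement_containing[OF subspace_span subspace_inter[OF Wj subspace_span]
          subspace_span Int_lower2])
  have "span (W j \<inter> ?F) \<subset> span (W j)"
    using nsub span_of_subspace[OF subspace_inter[OF Wj subspace_span]] span_of_subspace[OF Wj]
    by blast
  then have less: "dim (W j \<inter> ?F) < dim (W j)"
    by (rule dim_psubset)
  have "\<exists>x. x \<in> W i \<and> x \<noteq> 0 \<and> x \<in> L" if "i \<in> S" for i
  proof -
    have Wi: "subspace (W i)"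
      using W that \<open>S \<subseteq> I\<close> by blast
    have "W i \<subseteq> ?F"
      using that by (auto intro: span_base)
    then have "dim (L \<union> W i) \<le> dim ?F"
      using L(3) by (intro dim_subset) auto
    \<comment> \<open>This dimension is at least \<open>dim L + dim (W i) - dim ?F = dim (W i) - dim
      (W j \<inter> ?F)\<close>, which is positive.\<close>
    then have "dim (L \<inter> W i) \<noteq> 0"
      using dim_Un_plus_dim_Int[of L "W i"] L(5) less dims[OF that]
      unfolding span_of_subspace[OF L(1)] span_of_subspace[OF Wi] by linarith
    then have "\<not> L \<inter> W i \<subseteq> {0}"
      unfolding dim_eq_0 .
    then show ?thesis
      by blast
  qed
  then obtain x where x: "\<And>i. i \<in> S \<Longrightarrow> x i \<in> W i \<and> x i \<noteq> 0 \<and> x i \<in> L"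
    by metis
  define v where "v i = (if i \<in> S then x i else u i)" for i
  have "v ` (I - {j}) \<subseteq> L"
    using x L(2) span_superset[of "u ` (I - S - {j})"] by (auto simp: v_def)
  then have "span (v ` (I - {j})) \<subseteq> L"
    using L(1) by (rule span_minimal)
  then have "span (v ` (I - {j})) \<inter> W j \<subseteq> {0}"
    using L(3,4) by blast
  moreover have "\<forall>i\<in>I - {j}. v i \<in> W i \<and> v i \<noteq> 0"
    using x u by (simp add: v_def)
  then have "span (v ` (I - {j})) \<inter> W j \<noteq> {0}"
    using special unfolding local.special_at_def by blast
  ultimately show False
    using span_zero subspace_0[OF Wj] by blast
qed

text \<open>
  Given vectors \<open>u i\<close> for \<open>i \<in> I - S - {j}\<close>, only those with \<open>i\<close> in a tight set \<open>B\<close> are kept; the others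
  are replaced by representatives \<open>t i\<close> that are independent modulo \<open>G\<close>, the span of \<open>W j\<close> and the
  \<open>W i\<close> with \<open>i \<in> B\<close>, and in general position with respect to the span of the \<open>W i\<close> with \<open>i \<in> S\<close>.
  A dimension count inside \<open>G\<close> then rules out the case excluded in the previous lemma.
\<close>

lemma special_at_complement:
  assumes inf: "infinite (UNIV :: 'a set)" and "finite I" and W: "\<And>i. i \<in> I \<Longrightarrow> subspace (W i)"
    and "S \<subseteq> I" "j \<in> I - S" and special: "local.special_at I W j"
    and dims: "\<And>i. i \<in> S \<Longrightarrow> dim (W j) \<le> dim (W i)"
    and indep: "\<And>A. A \<subseteq> I - S \<Longrightarrow> dim (\<Union>(W ` S)) + card A \<le> dim (\<Union>(W ` S) \<union> \<Union>(W ` A))"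
  shows "local.special_at (I - S) W j"
  unfolding local.special_at_def
proof (intro allI impI)
  let ?J = "I - S - {j}" and ?E = "\<Union>(W ` S)"
  fix u assume u: "\<forall>i\<in>?J. u i \<in> W i \<and> u i \<noteq> 0"
  have Wj: "subspace (W j)"
    using W assms(5) by blast
  obtain B where B: "B \<subseteq> ?J" "B = {} \<or> dim (W j \<union> \<Union>(W ` B)) < dim (W j) + card B"
    "\<And>A. A \<subseteq> ?J - B \<Longrightarrow> dim (W j \<union> \<Union>(W ` B)) + card A \<le> dim (W j \<union> \<Union>(W ` B) \<union> \<Union>(W ` A))"
    using ex_tight_subset[OF finite_Diff[OF finite_Diff[OF \<open>finite I\<close>]], of S "{j}" "W j" W] by metis
  define G where "G = W j \<union> \<Union>(W ` B)"
  define D where "D = ?J - B"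
  have fin: "finite D" "finite B"
    using \<open>finite I\<close> B(1) by (auto simp: D_def intro: finite_subset)
  have dimG: "dim G \<le> dim (W j) + card B"
    using B(2) by (auto simp: G_def)
  \<comment> \<open>The extra 1 counts the index \<open>j\<close>, whose subspace is part of
    \<open>G\<close>.\<close>
  have EG: "dim ?E + 1 + card B + card A \<le> dim (?E \<union> G \<union> \<Union>(W ` A))" if "A \<subseteq> D" for A
  proof -
    have "finite A"
      using that fin finite_subset by blast
    then have "card (B \<union> A) = card B + card A"
      using that fin by (intro card_Un_disjoint) (auto simp: D_def)
    then have "card (insert j (B \<union> A)) = 1 + card B + card A"
      using that fin \<open>finite A\<close> B(1) by (subst card_insert_disjoint) (auto simp: D_def)
    moreover have "insert j (B \<union> A) \<subseteq> I - S"
      using that B(1) assms(5) by (auto simp: D_def)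
    moreover have "?E \<union> \<Union>(W ` insert j (B \<union> A)) = ?E \<union> G \<union> \<Union>(W ` A)"
      by (auto simp: G_def)
    ultimately show ?thesis
      using indep[of "insert j (B \<union> A)"] by (metis add.assoc)
  qed
  have WD: "subspace (W i)" if "i \<in> D" for i
    using that W by (simp add: D_def)
  have DG: "dim G + card A \<le> dim (G \<union> \<Union>(W ` A))" if "A \<subseteq> D" for A
    using B(3) that unfolding G_def D_def .
  obtain t where t: "\<forall>i\<in>D. t i \<in> W i" "dim G + card D \<le> dim (G \<union> t ` D)"
    "dim ?E + 1 + card B + card D \<le> dim (?E \<union> G \<union> t ` D)"
    using rado_representatives[OF inf fin(1) WD DG EG] by blast
  define v where "v i = (if i \<in> B then u i else t i)" for i
  have v: "v i \<in> W i \<and> v i \<noteq> 0" if "i \<in> ?J" for i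
    using that u t(1) nonzero_if_dim_Un_image[OF fin(1) t(2)] B(1) by (auto simp: v_def D_def)
  have vJ: "v ` ?J = u ` B \<union> t ` D"
    using B(1) by (auto simp: v_def D_def image_iff)
  have uB: "u ` B \<subseteq> span G" "W j \<subseteq> span G"
    using u B(1) by (auto simp: G_def intro!: span_base)
  have "span (v ` ?J) \<inter> W j \<noteq> {0}"
  proof
    assume miss: "span (v ` ?J) \<inter> W j = {0}"
    have "span (u ` B) \<inter> W j = {0}"
    proof -
      have "span (u ` B) \<subseteq> span (v ` ?J)"
        unfolding vJ by (intro span_mono) simp
      then have "span (u ` B) \<inter> W j \<subseteq> {0}"
        using miss by blast
      then show ?thesis
        using span_zero subspace_0[OF Wj] by blast
    qed
    then have dimU: "dim (u ` B \<union> W j) = dim (u ` B) + dim (W j)"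
      using dim_Un_plus_dim_Int[of "u ` B" "W j"] unfolding span_of_subspace[OF Wj] by simp
    let ?H = "?E \<union> v ` ?J"
    \<comment> \<open>Otherwise \<open>span G \<inter> span ?H\<close> contains \<open>u\<close>
      B\<open>and\<close>W j\<open>. But its dimension is\<close>dim G + dim ?H - dim (G \<union>
      ?H)\<open>, at most\<close>dim (W j) + dim (u \<open>B) - 1\<close> by the bounds on
      \<open>G\<close>, \<open>?H\<close> and \<open>t\<close>.\<close>
    have "\<not> W j \<subseteq> span ?H"
    proof
      assume "W j \<subseteq> span ?H"
      moreover have "u ` B \<subseteq> span ?H"
        unfolding vJ by (auto intro: span_base)
      ultimately have "u ` B \<union> W j \<subseteq> span G \<inter> span ?H"
        using uB by blast
      then have "dim (u ` B \<union> W j) \<le> dim (span G \<inter> span ?H)"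
        by (rule dim_subset)
      moreover have "dim (?E \<union> G \<union> t ` D) \<le> dim (G \<union> ?H)"
        unfolding vJ by (rule dim_subset) auto
      moreover have "dim ?H \<le> dim ?E + dim (u ` B) + card D"
        using dim_Un_le[of ?E "v ` ?J"] dim_Un_le[of "u ` B" "t ` D"] dim_image_le_card[OF fin(1), of t]
        by (simp add: vJ)
      ultimately show False
        using dim_Un_plus_dim_Int[of G ?H] dimU dimG t(3) by linarith
    qed
    from special_at_meets_outside[OF W assms(4,5) special dims v this] miss show False
      by contradiction
  qed
  moreover have "0 \<in> span (v ` ?J) \<inter> W j"
    using span_zero subspace_0[OF Wj] by simp
  \<comment> \<open>Independence of the \<open>t i\<close> modulo \<open>G\<close> removes them
    again, leaving only original vectors \<open>u i\<close>.\<close>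
  moreover have "span (v ` ?J) \<inter> W j \<subseteq> span (u ` B)"
    unfolding vJ by (rule span_Un_Int_absorb[OF uB span_Int_span_image_eq_0[OF fin(1) t(2)]])
  moreover have "span (u ` B) \<subseteq> span (u ` ?J)"
    using B(1) by (intro span_mono) auto
  ultimately show "span (u ` ?J) \<inter> W j \<noteq> {0}"
    by (rule Int_not_singleton_mono[OF _ _ order_trans])
qed

theorem special_dim_le_or_splits:
  assumes inf: "infinite (UNIV :: 'a set)" and "finite I" "I \<noteq> {}"
    and W: "\<And>i. i \<in> I \<Longrightarrow> subspace (W i)" and dims: "\<And>i. i \<in> I \<Longrightarrow> dim (W i) = k"
    and special: "\<And>j. j \<in> I \<Longrightarrow> local.special_at I W j"
  shows "dim (\<Union>(W ` I)) + 2 \<le> card I + k \<or>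
    (\<exists>S. S \<noteq> {} \<and> S \<subset> I \<and> (\<forall>j\<in>S. local.special_at S W j) \<and> (\<forall>j\<in>I - S. local.special_at (I - S) W j))"
proof -
  obtain o' where o': "o' \<in> I"
    using \<open>I \<noteq> {}\<close> by blast
  obtain B where B: "B \<subseteq> I - {o'}" "B = {} \<or> dim (W o' \<union> \<Union>(W ` B)) < dim (W o') + card B"
    "\<And>A. A \<subseteq> I - {o'} - B \<Longrightarrow>
      dim (W o' \<union> \<Union>(W ` B)) + card A \<le> dim (W o' \<union> \<Union>(W ` B) \<union> \<Union>(W ` A))"
    using ex_tight_subset[OF finite_Diff[OF \<open>finite I\<close>], of "{o'}" "W o'" W] by metis
  have "B \<noteq> {}"
  proof
    assume "B = {}"
    have fin: "finite (I - {o'})"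
      using \<open>finite I\<close> by simp
    obtain t where t: "\<forall>i\<in>I - {o'}. t i \<in> W i"
      "dim (W o') + card (I - {o'}) \<le> dim (W o' \<union> t ` (I - {o'}))"
      using rado_representatives[OF inf fin, of W "dim (W o')" "W o'" "dim (W o')" "W o'"] B(3) W
        \<open>B = {}\<close> by auto
    have "\<forall>i\<in>I - {o'}. t i \<in> W i \<and> t i \<noteq> 0"
      using t(1) nonzero_if_dim_Un_image[OF fin t(2)] by blast
    then have "span (t ` (I - {o'})) \<inter> W o' \<noteq> {0}"
      using special[OF o'] unfolding local.special_at_def by blast
    then show False
      using span_Int_span_image_eq_0[OF fin t(2)] unfolding span_of_subspace[OF W[OF o']]
      by blast
  qed
  define S where "S = insert o' B"
  have S: "S \<subseteq> I" "\<Union>(W ` S) = W o' \<union> \<Union>(W ` B)" "I - S = I - {o'} - B"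
    using B(1) o' by (auto simp: S_def)
  have indep: "dim (\<Union>(W ` S)) + card A \<le> dim (\<Union>(W ` S) \<union> \<Union>(W ` A))" if "A \<subseteq> I - S" for A
    using B(3) that unfolding S by blast
  show ?thesis
  proof (cases "S = I")
    case True
    have "finite B" "o' \<notin> B"
      using B(1) \<open>finite I\<close> finite_subset by auto
    then have "card I = Suc (card B)"
      unfolding True[symmetric] S_def by simp
    \<comment> \<open>One unit comes from the strict inequality in \<open>B(2)\<close>, the other
      from \<open>card I = card B + 1\<close>.\<close>
    then have "dim (\<Union>(W ` I)) + 2 \<le> card I + k"
      using B(2) \<open>B \<noteq> {}\<close> S(2) True dims[OF o'] by simp
    then show ?thesis ..
  next
    case False
    have "local.special_at S W j" if "j \<in> S" for j
      using special_at_independent_complement[OF inf \<open>finite I\<close> W S(1) that special indep] that S(1)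
      by blast
    moreover have "local.special_at (I - S) W j" if "j \<in> I - S" for j
      using special_at_complement[OF inf \<open>finite I\<close> W S(1) that special _ indep] that S(1) dims
      by (metis DiffD1 order_refl subsetD)
    moreover have "S \<noteq> {}" "S \<subset> I"
      using False S(1) by (auto simp: S_def)
    ultimately show ?thesis
      by blast
  qed
qed

end

section \<open>Translation to projective space\<close>

lemma meets_iff:
  assumes "vec.subspace L" "vec.subspace M"
  shows "meets L M \<longleftrightarrow> L \<inter> M \<noteq> {0}"
  using vec.subspace_0[OF assms(1)] vec.subspace_0[OF assms(2)] by (auto simp: meets_def)

lemma special_position_iff_special_at:
  fixes Lam :: "nat \<Rightarrow> ('m::finite) cvec set"
  assumes "CARD('m) = n + 1" and "k \<le> n"
    and Lam: "\<And>i. i \<in> I \<Longrightarrow> vec.subspace (Lam i)" "\<And>i. i \<in> I \<Longrightarrow> vec.dim (Lam i) = k"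
  shows "special_position (n - k) I Lam \<longleftrightarrow> (\<forall>j\<in>I. vec.special_at I Lam j)"
proof (intro iffI ballI)
  fix j assume sp: "special_position (n - k) I Lam" and j: "j \<in> I"
  show "vec.special_at I Lam j"
    unfolding vec.special_at_def
  proof (intro allI impI notI)
    fix u assume u: "\<forall>i\<in>I - {j}. u i \<in> Lam i \<and> u i \<noteq> 0"
      and "vec.span (u ` (I - {j})) \<inter> Lam j = {0}"
    then obtain L where L: "vec.subspace L" "vec.span (u ` (I - {j})) \<subseteq> L" "L \<inter> Lam j = {0}"
      "vec.dim L + vec.dim (Lam j) = vec.dim (UNIV :: 'm cvec set)"
      using vec.subspace_complement_containing[of UNIV "Lam j" "vec.span (u ` (I - {j}))"] Lam(1) j
      by auto
    \<comment> \<open>A complement of \<open>Lam j\<close> has vector dimension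
      \<open>n + 1 - k\<close>, which is projective dimension \<open>n - k\<close>.\<close>
    have "proj_subspace_of_dim L (n - k)"
      using L assms(1,2) Lam(2)[OF j] by (simp add: proj_subspace_of_dim_def card_cart_basis)
    moreover have "meets L (Lam i)" if "i \<in> I - {j}" for i
    proof -
      have "u i \<in> L"
        using that L(2) by (blast intro: vec.span_base)
      then show ?thesis
        using that u by (auto simp: meets_def)
    qed
    ultimately have "meets L (Lam j)"
      using sp j by (auto simp: special_position_def)
    then show False
      using L(1,3) Lam(1)[OF j] by (simp add: meets_iff)
  qed
next
  assume special: "\<forall>j\<in>I. vec.special_at I Lam j"
  show "special_position (n - k) I Lam"
    unfolding special_position_def
  proof (intro ballI allI impI, elim conjE)
    fix j L assume j: "j \<in> I" and L: "proj_subspace_of_dim L (n - k)"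
      and "\<forall>i\<in>I - {j}. meets L (Lam i)"
    then obtain u where u: "\<forall>i\<in>I - {j}. u i \<in> Lam i \<and> u i \<noteq> 0 \<and> u i \<in> L"
      unfolding meets_def by metis
    have sub: "vec.subspace L"
      using L by (simp add: proj_subspace_of_dim_def)
    have "vec.span (u ` (I - {j})) \<inter> Lam j \<noteq> {0}"
      using special j u by (auto simp: vec.special_at_def)
    moreover have "vec.span (u ` (I - {j})) \<subseteq> L"
      using u by (intro vec.span_minimal sub) auto
    ultimately show "meets L (Lam j)"
      using sub Lam(1)[OF j] vec.span_zero vec.subspace_0 by (subst meets_iff) blast+
  qed
qed

theorem theorem2p5:
  fixes n k d :: nat and Lam :: "nat \<Rightarrow> ('m::finite) cvec set"
  assumes "CARD('m) = n + 1"
    and "1 \<le> k" and "k \<le> n"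
    and "1 \<le> d"
    and "\<forall>i\<in>{1..d}. proj_subspace_of_dim (Lam i) (k - 1)"
    and "indecomposable (n - k) {1..d} Lam"
  shows "proj_span_dim (\<Union>i\<in>{1..d}. Lam i) \<le> int d + int k - 3"
proof -
  let ?I = "{1..d}"
  have Lam: "\<And>i. i \<in> ?I \<Longrightarrow> vec.subspace (Lam i)" "\<And>i. i \<in> ?I \<Longrightarrow> vec.dim (Lam i) = k"
    using assms(2,5) by (auto simp: proj_subspace_of_dim_def)
  have sp_iff: "special_position (n - k) S Lam \<longleftrightarrow> (\<forall>j\<in>S. vec.special_at S Lam j)" if "S \<subseteq> ?I" for S
    by (rule special_position_iff_special_at[OF assms(1,3) Lam]) (use that in blast)+
  have no_split: "\<not> (\<exists>S. S \<noteq> {} \<and> S \<subset> ?I \<and> (\<forall>j\<in>S. vec.special_at S Lam j) \<and>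
      (\<forall>j\<in>?I - S. vec.special_at (?I - S) Lam j))"
  proof (intro notI, elim exE conjE)
    fix S assume S: "S \<noteq> {}" "S \<subset> ?I" and sp: "\<forall>j\<in>S. vec.special_at S Lam j"
      "\<forall>j\<in>?I - S. vec.special_at (?I - S) Lam j"
    have "partition_on ?I {S, ?I - S}"
      using S by (intro partition_onI) (auto simp: disjnt_def)
    moreover have "card {S, ?I - S} \<ge> 2"
    proof -
      have "S \<noteq> ?I - S"
        using S(1) by blast
      then show ?thesis
        by simp
    qed
    moreover have "\<forall>p\<in>{S, ?I - S}. special_position (n - k) p Lam"
      using sp sp_iff[of S] sp_iff[of "?I - S"] S(2) by auto
    ultimately have "decomposable (n - k) ?I Lam"
      using assms(6) unfolding decomposable_def indecomposable_def by blast
    then show False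
      using assms(6) by (simp add: indecomposable_def)
  qed
  have special: "vec.special_at ?I Lam j" if "j \<in> ?I" for j
    using assms(6) sp_iff[OF order_refl] that unfolding indecomposable_def by blast
  have "?I \<noteq> {}"
    using assms(4) by simp
  from vec.special_dim_le_or_splits[OF infinite_UNIV_char_0 finite_atLeastAtMost this Lam special]
  have "vec.dim (\<Union>(Lam ` ?I)) + 2 \<le> card ?I + k"
    using no_split by blast
  \<comment> \<open>Passing to projective dimension subtracts one, which turns the 2 into the 3 of
    the claim.\<close>
  then show ?thesis
    by (simp add: proj_span_dim_def)
qed

end
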